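(* Let $\mathbf{A}$ be a normal and quasicomplemented distributive nearlattice and let $F$ be an $\alpha$-filter of $A$. Let $I_F=\{x\in A\colon \exists f\in F\ (x^{\top}\subseteq f^{\top\top})\}$. Then $I_F$ is an $\alpha$-ideal with $F=\ker\theta(I_F)$, and $\theta(I_F)$ is the smallest $\alpha$-ideal-congruence with this property: for every $\alpha$-ideal $J$ of $A$ with $F=\ker\theta(J)$ we have $\theta(I_F)\subseteq\theta(J)$.
   Context: A distributive nearlattice is a join-semilattice $\langle A,\vee,1\rangle$ with greatest element $1$ in which every principal filter $[a)=\{x\in A\colon a\le x\}$ is a bounded distributive lattice. A filter of $A$ is a subset containing $1$, upward closed, and closed under those binary meets that exist. An ideal is a non-empty subset that is downward closed and closed under $\vee$. For $a\in A$, $a^{\top}=\{x\in A\colon x\vee a=1\}$ and $a^{\top\top}=\{y\in A\colon y\vee x=1\text{ for all }x\in a^{\top}\}$. A filter $F$ is an $\alpha$-filter if $a^{\top\top}\subseteq F$ for all $a\in F$. An ideal $I$ is an $\alpha$-ideal if for each $a\in A$, $I\cap a^{\top\top}\neq\emptyset$ implies $a\in I$. For an ideal $I$, $\theta(I)=\{(a,b)\in A\times A\colon \exists i\in I\ (a\vee i=b\vee i)\}$, a congruence; congruences of the form $\theta(I)$ with $I$ an $\alpha$-ideal are called $\alpha$-ideal-congruences. For a congruence $\theta$, $\ker\theta=\{a\in A\colon (a,1)\in\theta\}$. A prime ideal is a proper ideal $P$ with $a\wedge b\in P\Rightarrow a\in P$ or $b\in P$ whenever $a\wedge b$ exists; a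 maximal ideal is a proper ideal not properly contained in any proper ideal. $\mathbf{A}$ is normal if each prime ideal is contained in a unique maximal ideal; $\mathbf{A}$ is quasicomplemented if for each $a\in A$ there exists $b\in A$ with $a^{\top\top}=b^{\top}$. *)

theory Defs
  imports Main
begin

definition (in order) is_meet_on :: "'a set \<Rightarrow> 'a \<Rightarrow> 'a \<Rightarrow> 'a \<Rightarrow> bool" where
  "is_meet_on S x y m \<longleftrightarrow>
     m \<in> S \<and> m \<le> x \<and> m \<le> y \<and> (\<forall>z\<in>S. z \<le> x \<and> z \<le> y \<longrightarrow> z \<le> m)"

definition (in order) is_join_on :: "'a set \<Rightarrow> 'a \<Rightarrow> 'a \<Rightarrow> 'a \<Rightarrow> bool" where
  "is_join_on S x y j \<longleftrightarrow>
     j \<in> S \<and> x \<le> j \<and> y \<le> j \<and> (\<forall>z\<in>S. x \<le> z \<and> y \<le> z \<longrightarrow> j \<le> z)"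

definition (in order) meet_on :: "'a set \<Rightarrow> 'a \<Rightarrow> 'a \<Rightarrow> 'a" where
  "meet_on S x y = (THE m. is_meet_on S x y m)"

definition (in order) join_on :: "'a set \<Rightarrow> 'a \<Rightarrow> 'a \<Rightarrow> 'a" where
  "join_on S x y = (THE j. is_join_on S x y j)"

text \<open>The subset \<open>S\<close> with the induced order is a bounded distributive lattice;
  meets and joins are taken inside \<open>S\<close>.\<close>

definition (in order) bounded_distributive_lattice_on :: "'a set \<Rightarrow> bool" where
  "bounded_distributive_lattice_on S \<longleftrightarrow>
     (\<exists>l\<in>S. \<forall>x\<in>S. l \<le> x) \<and> (\<exists>g\<in>S. \<forall>x\<in>S. x \<le> g) \<and>
     (\<forall>x\<in>S. \<forall>y\<in>S. (\<exists>m. is_meet_on S x y m) \<and> (\<exists>j. is_join_on S x y j)) \<and>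
     (\<forall>x\<in>S. \<forall>y\<in>S. \<forall>z\<in>S.
        meet_on S x (join_on S y z) = join_on S (meet_on S x y) (meet_on S x z))"

class distributive_nearlattice = semilattice_sup + order_top +
  assumes principal_filter: "bounded_distributive_lattice_on {a..}"

text \<open>Only binary meets that exist in the whole nearlattice are considered, so a meet is
  referred to through the relation \<open>is_meet_on UNIV\<close>.\<close>

definition nl_filter :: "'a::distributive_nearlattice set \<Rightarrow> bool" where
  "nl_filter F \<longleftrightarrow> top \<in> F \<and> (\<forall>x y. x \<in> F \<and> x \<le> y \<longrightarrow> y \<in> F) \<and>
     (\<forall>x y m. x \<in> F \<and> y \<in> F \<and> is_meet_on UNIV x y m \<longrightarrow> m \<in> F)"

definition nl_ideal :: "'a::distributive_nearlattice set \<Rightarrow> bool" where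
  "nl_ideal I \<longleftrightarrow> I \<noteq> {} \<and> (\<forall>x y. y \<in> I \<and> x \<le> y \<longrightarrow> x \<in> I) \<and>
     (\<forall>x y. x \<in> I \<and> y \<in> I \<longrightarrow> sup x y \<in> I)"

definition ann :: "'a::distributive_nearlattice \<Rightarrow> 'a set" where
  "ann a = {x. sup x a = top}"

definition double_ann :: "'a::distributive_nearlattice \<Rightarrow> 'a set" where
  "double_ann a = {y. \<forall>x\<in>ann a. sup y x = top}"

definition alpha_filter :: "'a::distributive_nearlattice set \<Rightarrow> bool" where
  "alpha_filter F \<longleftrightarrow> nl_filter F \<and> (\<forall>a\<in>F. double_ann a \<subseteq> F)"

definition alpha_ideal :: "'a::distributive_nearlattice set \<Rightarrow> bool" where
  "alpha_ideal I \<longleftrightarrow> nl_ideal I \<and> (\<forall>a. I \<inter> double_ann a \<noteq> {} \<longrightarrow> a \<in> I)"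

definition theta :: "'a::distributive_nearlattice set \<Rightarrow> ('a \<times> 'a) set" where
  "theta I = {(a, b). \<exists>i\<in>I. sup a i = sup b i}"

definition cong_ker :: "('a::distributive_nearlattice \<times> 'a) set \<Rightarrow> 'a set" where
  "cong_ker R = {a. (a, top) \<in> R}"

definition prime_ideal :: "'a::distributive_nearlattice set \<Rightarrow> bool" where
  "prime_ideal P \<longleftrightarrow> nl_ideal P \<and> P \<noteq> UNIV \<and>
     (\<forall>a b m. is_meet_on UNIV a b m \<and> m \<in> P \<longrightarrow> a \<in> P \<or> b \<in> P)"

definition maximal_ideal :: "'a::distributive_nearlattice set \<Rightarrow> bool" where
  "maximal_ideal M \<longleftrightarrow> nl_ideal M \<and> M \<noteq> UNIV \<and>
     \<not> (\<exists>I. nl_ideal I \<and> I \<noteq> UNIV \<and> M \<subset> I)"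

definition normal_nearlattice :: "'a::distributive_nearlattice itself \<Rightarrow> bool" where
  "normal_nearlattice T \<longleftrightarrow>
     (\<forall>P::'a set. prime_ideal P \<longrightarrow> (\<exists>!M. maximal_ideal M \<and> P \<subseteq> M))"

definition quasicomplemented :: "'a::distributive_nearlattice itself \<Rightarrow> bool" where
  "quasicomplemented T \<longleftrightarrow> (\<forall>a::'a. \<exists>b. double_ann a = ann b)"

definition ideal_of_filter :: "'a::distributive_nearlattice set \<Rightarrow> 'a set" where
  "ideal_of_filter F = {x. \<exists>f\<in>F. ann x \<subseteq> double_ann f}"

end

theory Submission
  imports Defs
begin

text \<open>Normality gives, via prime separation, that \<open>(x \<squnion> y)\<^sup>\<top>\<close> lies in every filter containing
  \<open>x\<^sup>\<top>\<close> and \<open>y\<^sup>\<top>\<close>: a prime ideal \<open>P\<close> disjoint from such a filter omits \<open>x\<^sup>\<top>\<close>, so \<open>P\<close> and \<open>x\<close>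
  together generate a proper ideal, and the unique maximal ideal above \<open>P\<close> contains \<open>x\<close>; the
  same holds for \<open>y\<close>. Hence \<open>P\<close> contains no \<open>z\<close> with \<open>z \<squnion> x \<squnion> y = \<top>\<close>.

  Two elements \<open>f\<close>, \<open>g\<close> of an \<open>\<alpha>\<close>-filter \<open>F\<close> need not have a meet. Instead, write
  \<open>f\<^sup>\<top>\<^sup>\<top> = f'\<^sup>\<top>\<close> and \<open>g\<^sup>\<top>\<^sup>\<top> = g'\<^sup>\<top>\<close> by quasicomplementation; then \<open>(f' \<squnion> g')\<^sup>\<top> \<subseteq> F\<close> by the above,
  and \<open>(f' \<squnion> g')\<^sup>\<top> = h\<^sup>\<top>\<^sup>\<top>\<close> for a quasicomplement \<open>h\<close> of \<open>f' \<squnion> g'\<close>, which therefore lies in \<open>F\<close>.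
  This \<open>h\<close> witnesses that \<open>I\<^sub>F\<close> is closed under joins.\<close>

section \<open>Meets and joins inside principal filters\<close>

context distributive_nearlattice
begin

lemma sup_top_absorb [simp]: "sup top a = top" "sup a top = top"
  by (simp_all add: sup.absorb1 sup.absorb2)

lemma is_join_on_principal_filter:
  assumes "m \<le> x" "m \<le> y"
  shows "is_join_on {m..} x y (sup x y)"
  using assms by (auto simp: is_join_on_def intro: le_supI1)

lemma join_on_principal_filter:
  assumes "m \<le> x" "m \<le> y"
  shows "join_on {m..} x y = sup x y"
  unfolding join_on_def
  using is_join_on_principal_filter[OF assms]
  by (rule the_equality)
    (use assms in \<open>auto simp: is_join_on_def le_supI1 intro: order.antisym\<close>)

lemma is_meet_on_meet_on:
  assumes "m \<le> x" "m \<le> y"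
  shows "is_meet_on {m..} x y (meet_on {m..} x y)"
proof -
  obtain k where k: "is_meet_on {m..} x y k"
    using principal_filter[of m] assms unfolding bounded_distributive_lattice_on_def
    by (meson atLeast_iff)
  then have "meet_on {m..} x y = k"
    unfolding meet_on_def
    by (rule the_equality) (use k in \<open>auto simp: is_meet_on_def intro!: order.antisym\<close>)
  with k show ?thesis by simp
qed

text \<open>Distributivity of the lattice \<open>{m..}\<close>: from \<open>t \<le> sup a b\<close>,
  the meet of \<open>t\<close> with \<open>sup a b\<close> is \<open>t\<close> itself, and it splits
  into the meets of \<open>t\<close> with \<open>a\<close> and with \<open>b\<close>.\<close>

lemma le_sup_decompose:
  assumes "m \<le> t" "m \<le> a" "m \<le> b" "t \<le> sup a b"
  obtains p q where "m \<le> p" "p \<le> t" "p \<le> a" "m \<le> q" "q \<le> t" "q \<le> b" "t = sup p q"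
proof -
  define p where "p = meet_on {m..} t a"
  define q where "q = meet_on {m..} t b"
  have p: "m \<le> p" "p \<le> t" "p \<le> a" and q: "m \<le> q" "q \<le> t" "q \<le> b"
    using is_meet_on_meet_on[of m t a] is_meet_on_meet_on[of m t b] assms
    by (auto simp: p_def q_def is_meet_on_def)
  have "meet_on {m..} t (join_on {m..} a b) = join_on {m..} p q"
    using principal_filter[of m] assms
    unfolding bounded_distributive_lattice_on_def p_def q_def by simp
  then have "meet_on {m..} t (sup a b) = sup p q"
    using p q assms by (simp add: join_on_principal_filter)
  moreover have "t \<le> meet_on {m..} t (sup a b)"
    using is_meet_on_meet_on[of m t "sup a b"] assms
    by (auto simp: is_meet_on_def intro: le_supI1)
  ultimately have "t = sup p q"
    using p q by (auto intro: order.antisym)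
  with p q show ?thesis using that by blast
qed

text \<open>This carries distributivity from the principal filters to the meets that exist globally.
  A lower bound is split along \<open>a\<close>, then its part below \<open>a\<close> along
  \<open>b\<close>; what escapes \<open>sup i m\<close> lies below both \<open>a\<close> and
  \<open>b\<close>, hence below \<open>m\<close>.\<close>

lemma is_meet_on_sup:
  assumes "is_meet_on UNIV a b m"
  shows "is_meet_on UNIV (sup i a) (sup i b) (sup i m)"
proof -
  have m: "m \<le> a" "m \<le> b" and greatest: "\<And>z. z \<le> a \<Longrightarrow> z \<le> b \<Longrightarrow> z \<le> m"
    using assms by (auto simp: is_meet_on_def)
  have "z \<le> sup i m" if z: "z \<le> sup i a" "z \<le> sup i b" for z
  proof -
    \<comment> \<open>\<open>z\<close> need not lie above \<open>m\<close>; joining with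
      \<open>m\<close> moves everything into \<open>{m..}\<close>.\<close>
    let ?i = "sup i m" and ?t = "sup z m"
    have ta: "?t \<le> sup ?i a" and tb: "?t \<le> sup ?i b"
      using z m by (simp_all add: sup.absorb2 sup.assoc le_supI2)
    obtain p q where pq: "p \<le> ?i" "m \<le> q" "q \<le> ?t" "q \<le> a" "?t = sup p q"
      using le_sup_decompose[OF sup_ge2 sup_ge2 m(1) ta] by metis
    have "q \<le> sup ?i b" using pq tb by (meson order.trans)
    then obtain r s where rs: "r \<le> ?i" "s \<le> q" "s \<le> b" "q = sup r s"
      using le_sup_decompose[OF pq(2) sup_ge2 m(2)] by metis
    have "s \<le> m" using rs pq greatest by (meson order.trans)
    then have "q \<le> ?i" using rs by (simp add: le_supI2)
    then have "?t \<le> ?i" using pq by simp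
    then show ?thesis by simp
  qed
  then show ?thesis using m by (auto simp: is_meet_on_def intro: le_supI2)
qed

end

section \<open>Filters, ideals and prime separation\<close>

lemma nl_filter_ann: "nl_filter (ann a)"
  unfolding nl_filter_def
proof (intro conjI allI impI)
  show "top \<in> ann a" by (simp add: ann_def)
next
  fix x y assume "x \<in> ann a \<and> x \<le> y"
  then show "y \<in> ann a"
    using sup_mono[of x y a a] by (simp add: ann_def top_unique)
next
  fix x y m assume *: "x \<in> ann a \<and> y \<in> ann a \<and> is_meet_on UNIV x y m"
  then have "is_meet_on UNIV (sup a x) (sup a y) (sup a m)"
    using is_meet_on_sup by blast
  then have "top \<le> sup a m"
    using * by (simp add: is_meet_on_def ann_def sup_commute)
  then show "m \<in> ann a" by (simp add: ann_def sup_commute top_unique)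
qed

lemma nl_ideal_neq_UNIV_iff:
  assumes "nl_ideal I"
  shows "I \<noteq> UNIV \<longleftrightarrow> I \<inter> {top} = {}"
  using assms top_greatest unfolding nl_ideal_def by blast

lemma nl_ideal_principal: "nl_ideal {..z}"
  by (auto simp: nl_ideal_def)

text \<open>This set is the ideal generated by \<open>I\<close> and \<open>x\<close>.\<close>

lemma nl_ideal_adjoin:
  assumes "nl_ideal I"
  shows "nl_ideal {w. \<exists>i\<in>I. w \<le> sup i x}"
  unfolding nl_ideal_def
proof (intro conjI allI impI)
  show "{w. \<exists>i\<in>I. w \<le> sup i x} \<noteq> {}"
    using assms unfolding nl_ideal_def by auto
next
  fix v w assume "w \<in> {w. \<exists>i\<in>I. w \<le> sup i x} \<and> v \<le> w"
  then show "v \<in> {w. \<exists>i\<in>I. w \<le> sup i x}" using order_trans by blast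
next
  fix v w assume "v \<in> {w. \<exists>i\<in>I. w \<le> sup i x} \<and> w \<in> {w. \<exists>i\<in>I. w \<le> sup i x}"
  then obtain i j where ij: "i \<in> I" "j \<in> I" "v \<le> sup i x" "w \<le> sup j x" by blast
  then have "sup i j \<in> I" using assms unfolding nl_ideal_def by blast
  moreover have "sup v w \<le> sup (sup i j) x"
    using sup_mono[OF ij(3,4)] by (simp add: ac_simps)
  ultimately show "sup v w \<in> {w. \<exists>i\<in>I. w \<le> sup i x}" by blast
qed

lemma subset_adjoin: "I \<subseteq> {w. \<exists>i\<in>I. w \<le> sup i (x::'a::semilattice_sup)}"
  by (auto intro: sup_ge1)

lemma adjoin_memI:
  assumes "nl_ideal I"
  shows "x \<in> {w. \<exists>i\<in>I. w \<le> sup i x}"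
  using assms unfolding nl_ideal_def by auto

text \<open>Zorn's lemma for an arbitrary \<open>G\<close>: the choice \<open>{top}\<close> yields
  maximal ideals, a filter yields prime ideals.\<close>

lemma nl_ideal_maximal_disjoint:
  assumes "nl_ideal J" "J \<inter> G = {}"
  obtains M where "nl_ideal M" "J \<subseteq> M" "M \<inter> G = {}"
    "\<And>I. nl_ideal I \<Longrightarrow> M \<subseteq> I \<Longrightarrow> I \<inter> G = {} \<Longrightarrow> I = M"
proof -
  let ?A = "{I. nl_ideal I \<and> J \<subseteq> I \<and> I \<inter> G = {}}"
  have "\<exists>M\<in>?A. \<forall>X\<in>?A. M \<subseteq> X \<longrightarrow> X = M"
  proof (rule subset_Zorn_nonempty)
    show "?A \<noteq> {}" using assms by blast
  next
    fix C assume C: "C \<noteq> {}" "subset.chain ?A C"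
    then have sub: "C \<subseteq> ?A" and lin: "\<And>X Y. X \<in> C \<Longrightarrow> Y \<in> C \<Longrightarrow> X \<subseteq> Y \<or> Y \<subseteq> X"
      unfolding subset.chain_def by blast+
    have "nl_ideal (\<Union>C)"
      unfolding nl_ideal_def
    proof (intro conjI allI impI)
      show "\<Union>C \<noteq> {}" using C(1) sub unfolding nl_ideal_def by blast
    next
      fix x y assume "y \<in> \<Union>C \<and> x \<le> y"
      then show "x \<in> \<Union>C" using sub unfolding nl_ideal_def by blast
    next
      fix x y assume "x \<in> \<Union>C \<and> y \<in> \<Union>C"
      then obtain X Y where XY: "X \<in> C" "Y \<in> C" "x \<in> X" "y \<in> Y" by blast
      then obtain Z where "Z \<in> C" "x \<in> Z" "y \<in> Z" using lin[of X Y] by blast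
      then show "sup x y \<in> \<Union>C" using sub unfolding nl_ideal_def by blast
    qed
    then show "\<Union>C \<in> ?A" using C(1) sub by blast
  qed
  then obtain M where "M \<in> ?A" "\<forall>X\<in>?A. M \<subseteq> X \<longrightarrow> X = M" by blast
  then show ?thesis using that[of M] by blast
qed

lemma maximal_ideal_extension:
  assumes "nl_ideal J" "top \<notin> J"
  obtains M where "maximal_ideal M" "J \<subseteq> M"
proof -
  have "J \<inter> {top} = {}" using assms by blast
  then obtain M where M: "nl_ideal M" "J \<subseteq> M" "M \<inter> {top} = {}"
    "\<And>I. nl_ideal I \<Longrightarrow> M \<subseteq> I \<Longrightarrow> I \<inter> {top} = {} \<Longrightarrow> I = M"
    using nl_ideal_maximal_disjoint[OF assms(1)] by metis
  then have "maximal_ideal M"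
    unfolding maximal_ideal_def by (metis nl_ideal_neq_UNIV_iff psubset_eq)
  with M(2) show ?thesis using that by blast
qed

lemma prime_ideal_separation:
  assumes K: "nl_filter K" and "z \<notin> K"
  obtains P where "prime_ideal P" "z \<in> P" "P \<inter> K = {}"
proof -
  have up: "\<And>x y. x \<in> K \<Longrightarrow> x \<le> y \<Longrightarrow> y \<in> K" and "top \<in> K"
    and meet: "\<And>x y m. x \<in> K \<Longrightarrow> y \<in> K \<Longrightarrow> is_meet_on UNIV x y m \<Longrightarrow> m \<in> K"
    using K unfolding nl_filter_def by blast+
  have "{..z} \<inter> K = {}" using up \<open>z \<notin> K\<close> by blast
  then obtain P where P: "nl_ideal P" "{..z} \<subseteq> P" "P \<inter> K = {}"
    and max: "\<And>I. nl_ideal I \<Longrightarrow> P \<subseteq> I \<Longrightarrow> I \<inter> K = {} \<Longrightarrow> I = P"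
    using nl_ideal_maximal_disjoint[OF nl_ideal_principal] by metis
  have sup_P: "\<And>x y. x \<in> P \<Longrightarrow> y \<in> P \<Longrightarrow> sup x y \<in> P"
    using P(1) by (auto simp: nl_ideal_def)
  \<comment> \<open>By maximality, the ideal generated by \<open>P\<close> and \<open>x\<close>
    meets \<open>K\<close>.\<close>
  have meets_K: "\<exists>i\<in>P. sup i x \<in> K" if "x \<notin> P" for x
  proof -
    have "{w. \<exists>i\<in>P. w \<le> sup i x} \<inter> K \<noteq> {}"
      using max[OF nl_ideal_adjoin[OF P(1)] subset_adjoin] adjoin_memI[OF P(1)] that by blast
    then show ?thesis using up by blast
  qed
  have "a \<in> P \<or> b \<in> P" if m: "is_meet_on UNIV a b m" "m \<in> P" for a b m
  proof (rule ccontr)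
    assume "\<not> (a \<in> P \<or> b \<in> P)"
    then obtain i j where ij: "i \<in> P" "j \<in> P" "sup i a \<in> K" "sup j b \<in> K"
      using meets_K by blast
    \<comment> \<open>With one common \<open>?k\<close>, the meet of \<open>sup ?k a\<close> and
      \<open>sup ?k b\<close> exists and equals \<open>sup ?k m\<close>.\<close>
    let ?k = "sup i j"
    have "sup ?k a \<in> K" "sup ?k b \<in> K"
      using up[OF ij(3)] up[OF ij(4)] by (simp_all add: le_supI1 le_supI2)
    then have "sup ?k m \<in> K" using meet is_meet_on_sup[OF m(1)] by blast
    moreover have "sup ?k m \<in> P" using ij m(2) sup_P by blast
    ultimately show False using P(3) by blast
  qed
  then have "prime_ideal P"
    using P \<open>top \<in> K\<close> by (auto simp: prime_ideal_def)
  then show ?thesis using that P by blast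
qed

section \<open>Annihilators, normality and quasicomplements\<close>

lemma normal_ann_sup_subset:
  fixes x y :: "'a::distributive_nearlattice"
  assumes normal: "normal_nearlattice TYPE('a)"
    and K: "nl_filter K" "ann x \<subseteq> K" "ann y \<subseteq> K"
  shows "ann (sup x y) \<subseteq> K"
proof
  fix z assume z: "z \<in> ann (sup x y)"
  show "z \<in> K"
  proof (rule ccontr)
    assume "z \<notin> K"
    then obtain P where P: "prime_ideal P" "z \<in> P" "P \<inter> K = {}"
      using prime_ideal_separation K(1) by metis
    then have "nl_ideal P" by (simp add: prime_ideal_def)
    obtain M where M: "maximal_ideal M" "P \<subseteq> M"
      and uniq: "\<And>N. maximal_ideal N \<Longrightarrow> P \<subseteq> N \<Longrightarrow> N = M"
      using normal P(1) unfolding normal_nearlattice_def by metis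
    have in_M: "w \<in> M" if "ann w \<subseteq> K" for w
    proof -
      let ?Q = "{v. \<exists>i\<in>P. v \<le> sup i w}"
      \<comment> \<open>If \<open>sup i w = top\<close> with \<open>i \<in> P\<close>, then
        \<open>i \<in> ann w \<subseteq> K\<close>, although \<open>P\<close> misses
        \<open>K\<close>.\<close>
      have "top \<notin> ?Q" using that P(3) by (auto simp: ann_def top_unique)
      then obtain N where "maximal_ideal N" "?Q \<subseteq> N"
        using maximal_ideal_extension nl_ideal_adjoin[OF \<open>nl_ideal P\<close>] by metis
      then show ?thesis
        using uniq[of N] subset_adjoin[of P w] adjoin_memI[OF \<open>nl_ideal P\<close>, of w] by blast
    qed
    have M': "nl_ideal M" "M \<noteq> UNIV" using M by (auto simp: maximal_ideal_def)
    have "x \<in> M" "y \<in> M" "z \<in> M" using in_M K P(2) M(2) by blast+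
    then have "sup z (sup x y) \<in> M"
      using M'(1) by (simp add: nl_ideal_def)
    then have "top \<in> M" using z by (simp add: ann_def)
    then show False using M' nl_ideal_neq_UNIV_iff by blast
  qed
qed

lemma ann_mono:
  assumes "x \<le> y"
  shows "ann x \<subseteq> ann y"
proof
  fix z assume "z \<in> ann x"
  then show "z \<in> ann y" using sup_mono[OF order_refl assms, of z] by (simp add: ann_def top_unique)
qed

lemma mem_double_ann: "a \<in> double_ann a"
  by (auto simp: double_ann_def ann_def sup_commute)

lemma ann_subset_of_mem_double_ann:
  assumes "y \<in> double_ann a"
  shows "ann a \<subseteq> ann y"
  using assms by (auto simp: double_ann_def ann_def sup_commute)

text \<open>Being quasicomplements is symmetric: \<open>k\<close> lies in
  \<open>double_ann k = ann h\<close>, and elements of \<open>ann k\<close> join with all of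
  \<open>double_ann k\<close> to \<open>top\<close>.\<close>

lemma double_ann_eq_ann_swap:
  assumes "double_ann k = ann h"
  shows "double_ann h = ann k"
proof
  show "double_ann h \<subseteq> ann k"
    using mem_double_ann[of k] assms by (auto simp: double_ann_def ann_def)
  show "ann k \<subseteq> double_ann h"
    unfolding double_ann_def assms[symmetric]
    by (auto simp: double_ann_def sup_commute)
qed

section \<open>The ideal of an \<alpha>-filter and its congruence\<close>

lemma cong_ker_theta: "cong_ker (theta I) = {a. \<exists>i\<in>I. sup a i = top}"
  by (simp add: cong_ker_def theta_def)

lemma ideal_of_filter_sup_closed:
  fixes F :: "'a::distributive_nearlattice set"
  assumes normal: "normal_nearlattice TYPE('a)"
    and quasi: "quasicomplemented TYPE('a)"
    and F: "alpha_filter F"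
    and "x \<in> ideal_of_filter F" "y \<in> ideal_of_filter F"
  shows "sup x y \<in> ideal_of_filter F"
proof -
  obtain f g where fg: "f \<in> F" "g \<in> F" "ann x \<subseteq> double_ann f" "ann y \<subseteq> double_ann g"
    using assms(4,5) by (auto simp: ideal_of_filter_def)
  obtain f' g' where fg': "double_ann f = ann f'" "double_ann g = ann g'"
    using quasi unfolding quasicomplemented_def by metis
  let ?k = "sup f' g'"
  obtain h where "double_ann ?k = ann h"
    using quasi unfolding quasicomplemented_def by metis
  then have h: "double_ann h = ann ?k" by (rule double_ann_eq_ann_swap)
  have "nl_filter F" "ann f' \<subseteq> F" "ann g' \<subseteq> F"
    using F fg unfolding alpha_filter_def fg'[symmetric] by blast+
  then have "ann ?k \<subseteq> F" by (rule normal_ann_sup_subset[OF normal])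
  then have "h \<in> F" using h mem_double_ann by blast
  have "ann f' \<subseteq> ann ?k" "ann g' \<subseteq> ann ?k"
    by (simp_all add: ann_mono)
  then have "ann x \<subseteq> ann ?k" "ann y \<subseteq> ann ?k" using fg fg' by auto
  \<comment> \<open>Normality is used a second time, now with the filter \<open>ann ?k\<close> in
    place of \<open>F\<close>.\<close>
  then have "ann (sup x y) \<subseteq> double_ann h"
    unfolding h by (rule normal_ann_sup_subset[OF normal nl_filter_ann])
  with \<open>h \<in> F\<close> show ?thesis by (auto simp: ideal_of_filter_def)
qed

lemma alpha_ideal_ideal_of_filter:
  fixes F :: "'a::distributive_nearlattice set"
  assumes normal: "normal_nearlattice TYPE('a)"
    and quasi: "quasicomplemented TYPE('a)"
    and F: "alpha_filter F"
  shows "alpha_ideal (ideal_of_filter F)"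
  unfolding alpha_ideal_def nl_ideal_def
proof (intro conjI allI impI)
  \<comment> \<open>A quasicomplement of \<open>top\<close> belongs to the ideal, with
    \<open>top\<close> itself as the witness from \<open>F\<close>.\<close>
  obtain b :: 'a where "double_ann top = ann b"
    using quasi unfolding quasicomplemented_def by metis
  moreover have "top \<in> F" using F by (simp add: alpha_filter_def nl_filter_def)
  ultimately show "ideal_of_filter F \<noteq> {}" by (auto simp: ideal_of_filter_def)
next
  fix x y assume *: "y \<in> ideal_of_filter F \<and> x \<le> y"
  then have "ann x \<subseteq> ann y" by (simp add: ann_mono)
  then show "x \<in> ideal_of_filter F" using * by (auto simp: ideal_of_filter_def)
next
  fix x y assume "x \<in> ideal_of_filter F \<and> y \<in> ideal_of_filter F"
  then show "sup x y \<in> ideal_of_filter F"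
    using ideal_of_filter_sup_closed[OF assms] by blast
next
  fix a assume "ideal_of_filter F \<inter> double_ann a \<noteq> {}"
  then obtain y f where "f \<in> F" "ann y \<subseteq> double_ann f" "y \<in> double_ann a"
    by (auto simp: ideal_of_filter_def)
  then show "a \<in> ideal_of_filter F"
    using ann_subset_of_mem_double_ann by (fastforce simp: ideal_of_filter_def)
qed

lemma cong_ker_theta_ideal_of_filter:
  fixes F :: "'a::distributive_nearlattice set"
  assumes quasi: "quasicomplemented TYPE('a)"
    and F: "alpha_filter F"
  shows "cong_ker (theta (ideal_of_filter F)) = F"
proof
  show "cong_ker (theta (ideal_of_filter F)) \<subseteq> F"
    \<comment> \<open>If \<open>sup a i = top\<close> and
      \<open>ann i \<subseteq> double_ann f\<close>, then
      \<open>a \<in> ann i \<subseteq> double_ann f \<subseteq> F\<close>.\<close>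
    using F unfolding cong_ker_theta alpha_filter_def ideal_of_filter_def ann_def by blast
  show "F \<subseteq> cong_ker (theta (ideal_of_filter F))"
  proof
    fix a assume "a \<in> F"
    obtain b where b: "double_ann a = ann b"
      using quasi unfolding quasicomplemented_def by metis
    then have "b \<in> ideal_of_filter F" using \<open>a \<in> F\<close> by (auto simp: ideal_of_filter_def)
    moreover have "sup a b = top" using mem_double_ann[of a] b by (simp add: ann_def)
    ultimately show "a \<in> cong_ker (theta (ideal_of_filter F))"
      by (auto simp: cong_ker_theta)
  qed
qed

text \<open>This gives minimality, as \<open>theta\<close> is monotone. If
  \<open>sup f j = top\<close>, then \<open>j\<close> joins with every element of
  \<open>double_ann f\<close>, hence of \<open>ann x\<close>, to \<open>top\<close>; so
  \<open>j \<in> double_ann x\<close>, and the \<alpha>-ideal \<open>J\<close> must contain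
  \<open>x\<close>.\<close>

lemma ideal_of_filter_cong_ker_subset:
  assumes "alpha_ideal J"
  shows "ideal_of_filter (cong_ker (theta J)) \<subseteq> J"
proof
  fix x assume "x \<in> ideal_of_filter (cong_ker (theta J))"
  then obtain f j where "ann x \<subseteq> double_ann f" "j \<in> J" "sup f j = top"
    by (auto simp: ideal_of_filter_def cong_ker_theta)
  then have "j \<in> double_ann x"
    by (auto simp: double_ann_def ann_def sup_commute)
  then show "x \<in> J" using assms \<open>j \<in> J\<close> by (auto simp: alpha_ideal_def)
qed

theorem theorem3p16:
  fixes F :: "'a::distributive_nearlattice set"
  assumes "normal_nearlattice TYPE('a)"
    and "quasicomplemented TYPE('a)"
    and "alpha_filter F"
  shows "alpha_ideal (ideal_of_filter F) \<and>
    F = cong_ker (theta (ideal_of_filter F)) \<and>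
    (\<forall>J. alpha_ideal J \<and> F = cong_ker (theta J) \<longrightarrow>
      theta (ideal_of_filter F) \<subseteq> theta J)"
proof (intro conjI allI impI)
  show "alpha_ideal (ideal_of_filter F)"
    using assms by (rule alpha_ideal_ideal_of_filter)
  show "F = cong_ker (theta (ideal_of_filter F))"
    using cong_ker_theta_ideal_of_filter[OF assms(2,3)] by simp
  fix J assume "alpha_ideal J \<and> F = cong_ker (theta J)"
  then have "ideal_of_filter F \<subseteq> J" using ideal_of_filter_cong_ker_subset by blast
  then show "theta (ideal_of_filter F) \<subseteq> theta J" by (auto simp: theta_def)
qed

end
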